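(* For all positive integers $a,n$, $$\nu_5 \left( {5^a n \choose n}_F \right) = \nu_5 \left( {5^a n \choose n} \right) = \frac{s_5 ((5^a - 1)n)}{4}.$$ In particular, ${5^an \choose n}_F$ is divisible by $5$ for all positive integers $a,n$.
   Context: The Fibonacci sequence is $F_1=F_2=1$, $F_n=F_{n-1}+F_{n-2}$ for $n\ge 3$. For $m\ge 1$ and $1\le k\le m$ the Fibonomial coefficient is ${m \choose k}_F = \frac{F_1F_2\cdots F_m}{(F_1\cdots F_k)(F_1\cdots F_{m-k})}$ (an integer). $\nu_5(x)$ is the exponent of $5$ in $x$, ${m\choose k}$ is the ordinary binomial coefficient, and $s_5(n)$ is the sum of the base-$5$ digits of $n$. *)

theory Defs
  imports "HOL-Number_Theory.Number_Theory"
begin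

definition fibonorial :: "nat \<Rightarrow> nat" where
  "fibonorial m = (\<Prod>i=1..m. fib i)"

text \<open>
  The division is exact for \<open>k \<le> m\<close>; see \<open>of_nat_fibonomial\<close> below.
\<close>

definition fibonomial :: "nat \<Rightarrow> nat \<Rightarrow> nat" where
  "fibonomial m k = fibonorial m div (fibonorial k * fibonorial (m - k))"

lemma fibonorial_0 [simp]: "fibonorial 0 = 1"
  by (simp add: fibonorial_def)

lemma fibonorial_Suc: "fibonorial (Suc m) = fib (Suc m) * fibonorial m"
  by (simp add: fibonorial_def prod.nat_ivl_Suc' mult.commute)

lemma fibonorial_pos: "fibonorial m > 0"
  by (auto simp: fibonorial_def intro!: prod_pos fib_neq_0_nat)

lemma fibonorial_mult_dvd: "fibonorial k * fibonorial j dvd fibonorial (k + j)"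
proof (induction "k + j" arbitrary: k j)
  case 0
  then show ?case by simp
next
  case (Suc N)
  show ?case
  proof (cases "k = 0 \<or> j = 0")
    case True
    then show ?thesis by auto
  next
    case False
    then obtain k' j' where kj: "k = Suc k'" "j = Suc j'"
      by (metis not0_implies_Suc)
    have N: "N = k' + j" "N = k + j'" using Suc.hyps(2) kj by auto
    have 1: "fibonorial k' * fibonorial j dvd fibonorial N"
      using Suc.hyps(1)[OF N(1)] N(1) by simp
    have 2: "fibonorial k * fibonorial j' dvd fibonorial N"
      using Suc.hyps(1)[OF N(2)] N(2) by simp
    have "fib (Suc N) = fib (Suc (k' + j))" using N by simp
    also have "\<dots> = fib (Suc j) * fib k + fib j * fib k'"
      using fib_add[of k' j] kj by simp
    finally have f: "fibonorial (k + j) =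
        fib (Suc j) * (fib k * fibonorial N) + fib k' * (fib j * fibonorial N)"
      using Suc.hyps(2)[symmetric] by (simp add: fibonorial_Suc algebra_simps)
    have "fibonorial k * fibonorial j dvd fib k * fibonorial N"
      using mult_dvd_mono[OF dvd_refl[of "fib k"] 1] kj
      by (simp add: fibonorial_Suc mult.assoc del: fib.simps)
    moreover have "fibonorial k * fibonorial j dvd fib j * fibonorial N"
      using mult_dvd_mono[OF dvd_refl[of "fib j"] 2] kj
      by (simp add: fibonorial_Suc mult_ac del: fib.simps)
    ultimately show ?thesis
      unfolding f by (metis dvd_add dvd_mult)
  qed
qed

lemma of_nat_fibonomial:
  assumes "k \<le> m"
  shows "(of_nat (fibonomial m k) :: 'a :: field_char_0) =
    of_nat (fibonorial m) / (of_nat (fibonorial k) * of_nat (fibonorial (m - k)))"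
proof -
  let ?d = "fibonorial k * fibonorial (m - k)"
  have "fibonomial m k * ?d = fibonorial m"
    using fibonorial_mult_dvd[of k "m - k"] assms by (simp add: fibonomial_def)
  then have "(of_nat (fibonomial m k) :: 'a) * of_nat ?d = of_nat (fibonorial m)"
    by (metis of_nat_mult)
  moreover have "(of_nat ?d :: 'a) \<noteq> 0"
    using fibonorial_pos[of k] fibonorial_pos[of "m - k"] by simp
  ultimately show ?thesis
    by (simp add: eq_divide_eq)
qed

fun digit_sum5 :: "nat \<Rightarrow> nat" where
  "digit_sum5 n = (if n = 0 then 0 else n mod 5 + digit_sum5 (n div 5))"

declare digit_sum5.simps [simp del]

end

theory Submission
  imports Defs
begin

text \<open>
  The identity \<open>F(5n) = 5 F(n) (5 F(n)^4 + 5 (-1)^n F(n)^2 + 1)\<close>, together with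
  \<open>gcd (F 5) (F n) = F (gcd 5 n)\<close>, shows that \<open>F n\<close> and \<open>n\<close> contain the same power of 5.
  Hence so do fibonorials and factorials, and Fibonomial and binomial coefficients. Legendre's
  formula \<open>4 \<nu>(n!) = n - s(n)\<close> then evaluates the common exponent, since \<open>s(5^a n) = s(n)\<close>.
\<close>

text \<open>Writing \<open>F(n-1)\<close> as \<open>F(n+1) - F(n)\<close> keeps the addition law
  valid at \<open>n = 0\<close>; the subtraction is why it is stated over
  \<open>int\<close>.\<close>

lemma int_fib_add: "int (fib (m + n)) =
    int (fib (Suc m)) * int (fib n) + int (fib m) * (int (fib (Suc n)) - int (fib n))"
proof (cases n)
  case (Suc k)
  then show ?thesis
    using fib_add[of k m] by (simp add: algebra_simps)
qed simp

lemma int_fib_5_mult: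
  "int (fib (5 * n)) = 5 * int (fib n) * (5 * int (fib n) ^ 4 + 5 * (-1) ^ n * int (fib n) ^ 2 + 1)"
proof -
  define x where "x = int (fib n)"
  define y where "y = int (fib (Suc n))"
  \<comment> \<open>By Cassini's identity this quadratic form in consecutive Fibonacci numbers is a
    sign, so \<open>e ^ 2 = 1\<close>.\<close>
  define e where "e = y ^ 2 - x * y - x ^ 2"
  have e: "e = (-1) ^ n"
    using fib_Cassini_int[of n] by (simp add: e_def x_def y_def power2_eq_square algebra_simps)
  have f2: "int (fib (2 * n)) = x * (2 * y - x)"
    unfolding mult_2[of n] int_fib_add x_def y_def by (simp add: algebra_simps)
  have s2: "int (fib (Suc (2 * n))) = x ^ 2 + y ^ 2"
    by (simp add: fib_rec_odd x_def y_def)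
  \<comment> \<open>The index \<open>5 * n\<close> is reached by doubling \<open>n\<close> twice and
    adding \<open>n\<close>.\<close>
  have four: "4 * n = 2 * n + 2 * n" "4 * n = 2 * (2 * n)"
    by simp_all
  have f4: "int (fib (4 * n)) = x * (2 * y - x) * (2 * (x ^ 2 + y ^ 2) - x * (2 * y - x))"
    unfolding four(1) int_fib_add f2 s2 by (simp add: algebra_simps)
  have s4: "int (fib (Suc (4 * n))) = (x * (2 * y - x)) ^ 2 + (x ^ 2 + y ^ 2) ^ 2"
    unfolding four(2) fib_rec_odd of_nat_add of_nat_power f2 x_def[symmetric] y_def[symmetric] ..
  have "int (fib (5 * n)) = int (fib (4 * n + n))"
    by simp
  \<comment> \<open>With \<open>e\<close> expanded, this is an identity of homogeneous polynomials
    of degree 5 in \<open>x\<close> and \<open>y\<close>; keeping \<open>e ^ 2\<close> makes it hold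
    without Cassini.\<close>
  also have "\<dots> = 5 * x * (5 * x ^ 4 + 5 * e * x ^ 2 + e ^ 2)"
    unfolding int_fib_add f4 s4 e_def x_def[symmetric] y_def[symmetric]
    by (simp add: algebra_simps power2_eq_square power4_eq_xxxx)
  also have "e ^ 2 = 1"
    by (simp add: e flip: power_mult)
  finally show ?thesis
    by (simp add: e x_def)
qed

lemma five_dvd_fib_iff: "5 dvd fib n \<longleftrightarrow> 5 dvd n"
proof -
  have fib5: "fib 5 = 5"
    by (simp add: numeral_eq_Suc)
  have "prime (5 :: nat)"
    by simp
  then consider "gcd 5 n = 1" "\<not> 5 dvd n" | "gcd 5 n = 5" "5 dvd n"
    by (metis coprime_iff_gcd_eq_1 gcd_nat.absorb1 prime_imp_coprime)
  then show ?thesis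
  proof cases
    case 1
    then have "gcd 5 (fib n) = 1"
      using fib_gcd[of 5 n] fib5 by simp
    then have "\<not> 5 dvd fib n"
      by (metis gcd_nat.absorb1 num.distinct(3) numeral_eq_one_iff)
    with 1 show ?thesis by simp
  next
    case 2
    then have "gcd 5 (fib n) = 5"
      using fib_gcd[of 5 n] fib5 by simp
    then have "5 dvd fib n"
      by (metis gcd_dvd2)
    with 2 show ?thesis by simp
  qed
qed

lemma multiplicity_5_mult:
  assumes "n > (0 :: nat)"
  shows "multiplicity 5 (5 * n) = Suc (multiplicity 5 n)"
  using assms by (simp add: multiplicity_times_same)

text \<open>In the formula for \<open>F(5n)\<close> the cofactor \<open>q\<close> is 1 modulo 5, so
  only the explicit factor 5 adds to the exponent.\<close>

lemma multiplicity_5_fib_5_mult: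
  assumes "n > 0"
  shows "multiplicity 5 (fib (5 * n)) = Suc (multiplicity 5 (fib n))"
proof -
  define x where "x = int (fib n)"
  define q where "q = 5 * (x ^ 4 + (-1) ^ n * x ^ 2) + 1"
  have eq: "int (fib (5 * n)) = 5 * (x * q)"
    unfolding int_fib_5_mult x_def q_def by (simp add: algebra_simps)
  have "q mod 5 = 1"
    unfolding q_def by presburger
  then have q: "\<not> 5 dvd q"
    by auto
  have "x > 0" "int (fib (5 * n)) > 0"
    using assms by (simp_all add: x_def fib_neq_0_nat)
  \<comment> \<open>Positivity lets \<open>q\<close> be read as a natural number \<open>k\<close>,
    where the multiplicity is taken.\<close>
  then have "q > 0"
    unfolding eq by (simp add: zero_less_mult_iff)
  then obtain k where k: "q = int k"
    by (metis nonneg_int_cases less_imp_le)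
  have "int (fib (5 * n)) = int (5 * (fib n * k))"
    unfolding eq by (simp add: x_def k)
  then have "fib (5 * n) = 5 * (fib n * k)"
    by (simp only: of_nat_eq_iff)
  moreover have "k > 0" and "\<not> 5 dvd k"
    using \<open>q > 0\<close> q k by auto
  ultimately show ?thesis
    using fib_neq_0_nat[OF assms] multiplicity_5_mult[of "fib n * k"]
    by (simp add: prime_elem_multiplicity_mult_distrib not_dvd_imp_multiplicity_0)
qed

text \<open>Each factor 5 stripped from \<open>n\<close> lowers both sides by one; once 5 does not
  divide \<open>n\<close>, both are 0.\<close>

lemma multiplicity_5_fib:
  assumes "n > 0"
  shows "multiplicity 5 (fib n) = multiplicity 5 n"
  using assms
proof (induction n rule: less_induct)
  case (less n)
  show ?case
  proof (cases "5 dvd n")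
    case True
    then obtain k where "n = 5 * k" ..
    with less show ?thesis
      by (simp add: multiplicity_5_fib_5_mult multiplicity_5_mult)
  next
    case False
    then show ?thesis
      by (simp add: five_dvd_fib_iff not_dvd_imp_multiplicity_0)
  qed
qed

lemma multiplicity_5_fibonorial: "multiplicity 5 (fibonorial n) = multiplicity 5 (fact n :: nat)"
proof (induction n)
  case (Suc n)
  have "fib (Suc n) > 0"
    by (rule fib_neq_0_nat) simp
  then have "multiplicity 5 (fibonorial (Suc n)) =
      multiplicity 5 (fib (Suc n)) + multiplicity 5 (fibonorial n)"
    using fibonorial_pos[of n] by (simp add: fibonorial_Suc prime_elem_multiplicity_mult_distrib)
  also have "\<dots> = multiplicity 5 (Suc n) + multiplicity 5 (fact n :: nat)"
    using Suc by (simp add: multiplicity_5_fib)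
  also have "\<dots> = multiplicity 5 (Suc n * fact n)"
    by (subst prime_elem_multiplicity_mult_distrib) auto
  finally show ?case
    by simp
qed simp

text \<open>Passing from \<open>n\<close> to \<open>5 * n + r\<close> appends \<open>r\<close> as
  last base-5 digit.\<close>

lemma digit_sum5_5_mult_add:
  assumes "r < 5"
  shows "digit_sum5 (5 * n + r) = r + digit_sum5 n"
  using assms digit_sum5.simps[of "5 * n + r"] by (auto simp: digit_sum5.simps[of 0])

lemma digit_sum5_power_mult: "digit_sum5 (5 ^ a * n) = digit_sum5 n"
proof (induction a)
  case (Suc a)
  then show ?case
    using digit_sum5_5_mult_add[of 0 "5 ^ a * n"] by (simp add: mult.assoc)
qed simp

lemma digit_sum5_pos:
  assumes "n > 0"
  shows "digit_sum5 n > 0"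
  using assms
proof (induction n rule: less_induct)
  case (less n)
  show ?case
  proof (cases "n mod 5 = 0")
    case True
    then have "0 < n div 5" "n div 5 < n"
      using less.prems by auto
    then have "digit_sum5 (n div 5) > 0"
      by (intro less.IH)
    then show ?thesis
      using less.prems by (subst digit_sum5.simps) simp
  next
    case False
    then show ?thesis
      using less.prems by (subst digit_sum5.simps) simp
  qed
qed

text \<open>Passing from \<open>n\<close> to \<open>Suc n\<close> turns one trailing digit 4 into 0 for each factor 5 of \<open>Suc n\<close>.\<close>

lemma digit_sum5_Suc: "4 * multiplicity 5 (Suc n) + digit_sum5 (Suc n) = Suc (digit_sum5 n)"
proof (induction n rule: less_induct)
  case (less n)
  define k r where "k = n div 5" and "r = n mod 5"
  have n: "n = 5 * k + r" "r < 5"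
    by (simp_all add: k_def r_def)
  show ?case
  proof (cases "r = 4")
    case True
    then have "Suc n = 5 * Suc k" "k < n"
      using n by simp_all
    then show ?thesis
      using less.IH[of k] digit_sum5_5_mult_add[of 4 k] digit_sum5_5_mult_add[of 0 "Suc k"]
        multiplicity_5_mult[of "Suc k"] n True by simp
  next
    case False
    then have "Suc n = 5 * k + Suc r" "Suc r < 5"
      using n by simp_all
    moreover from this have "\<not> 5 dvd Suc n"
      by presburger
    ultimately show ?thesis
      using digit_sum5_5_mult_add[of "Suc r" k] digit_sum5_5_mult_add[of r k] n
      by (simp add: not_dvd_imp_multiplicity_0)
  qed
qed

text \<open>Summing \<open>digit_sum5_Suc\<close> over the factors of the factorial makes the digit
  sums telescope.\<close>

lemma legendre_formula_5: "4 * multiplicity 5 (fact n :: nat) + digit_sum5 n = n"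
proof (induction n)
  case 0
  then show ?case
    by (simp add: digit_sum5.simps)
next
  case (Suc n)
  have "multiplicity 5 (fact (Suc n) :: nat) = multiplicity 5 (Suc n * fact n)"
    by simp
  also have "\<dots> = multiplicity 5 (Suc n) + multiplicity 5 (fact n :: nat)"
    by (subst prime_elem_multiplicity_mult_distrib) auto
  finally show ?case
    using Suc digit_sum5_Suc[of n] by simp
qed

lemma multiplicity_5_choose:
  assumes "k \<le> m"
  shows "multiplicity 5 (m choose k) + multiplicity 5 (fact k :: nat)
      + multiplicity 5 (fact (m - k) :: nat) = multiplicity 5 (fact m :: nat)"
proof -
  have "fact m = fact k * fact (m - k) * (m choose k)"
    using binomial_fact_lemma[OF assms] by simp
  then show ?thesis
    using assms by (simp add: prime_elem_multiplicity_mult_distrib)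
qed

text \<open>Both coefficients satisfy the same product relation, one over fibonorials and one over
  factorials, and these have equal exponents of 5.\<close>

lemma multiplicity_5_fibonomial:
  assumes "k \<le> m"
  shows "multiplicity 5 (fibonomial m k) = multiplicity 5 (m choose k)"
proof -
  have eq: "fibonorial m = fibonomial m k * (fibonorial k * fibonorial (m - k))"
    using fibonorial_mult_dvd[of k "m - k"] assms by (simp add: fibonomial_def)
  then have "fibonomial m k \<noteq> 0"
    using fibonorial_pos[of m] by auto
  then have "multiplicity 5 (fibonorial m) = multiplicity 5 (fibonomial m k)
      + multiplicity 5 (fibonorial k) + multiplicity 5 (fibonorial (m - k))"
    using fibonorial_pos[of k] fibonorial_pos[of "m - k"]
    by (simp add: eq prime_elem_multiplicity_mult_distrib)
  with multiplicity_5_choose[OF assms] show ?thesis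
    by (simp add: multiplicity_5_fibonorial)
qed

theorem theorem11:
  fixes a n :: nat
  assumes "a > 0" and "n > 0"
  shows "multiplicity 5 (fibonomial (5 ^ a * n) n) = multiplicity 5 ((5 ^ a * n) choose n)
    \<and> real (multiplicity 5 ((5 ^ a * n) choose n)) = real (digit_sum5 ((5 ^ a - 1) * n)) / 4
    \<and> 5 dvd fibonomial (5 ^ a * n) n"
proof -
  define m where "m = (5 ^ a - 1) * n"
  have "(5 :: nat) ^ a > 1"
    using assms one_less_power[of "5 :: nat" a] by simp
  then have "m > 0" and le: "n \<le> 5 ^ a * n" and m: "5 ^ a * n - n = m" "5 ^ a * n = m + n"
    using assms by (simp_all add: m_def diff_mult_distrib)
  have fib: "multiplicity 5 (fibonomial (5 ^ a * n) n) = multiplicity 5 ((5 ^ a * n) choose n)"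
    using multiplicity_5_fibonomial[OF le] .
  \<comment> \<open>Legendre's formula at \<open>n\<close>, \<open>m\<close> and
    \<open>m + n\<close> gives \<open>s(n) + s(m) - s(m + n)\<close>, as the linear terms cancel;
    \<open>m + n = 5 ^ a * n\<close> has the digit sum of \<open>n\<close>, which leaves
    \<open>s(m)\<close>.\<close>
  have four: "4 * multiplicity 5 ((5 ^ a * n) choose n) = digit_sum5 m"
    using multiplicity_5_choose[OF le] legendre_formula_5[of n] legendre_formula_5[of m]
      legendre_formula_5[of "5 ^ a * n"] digit_sum5_power_mult[of a n] m
    by simp
  then have "multiplicity 5 (fibonomial (5 ^ a * n) n) > 0"
    using fib digit_sum5_pos[OF \<open>m > 0\<close>] by simp
  then have "5 dvd fibonomial (5 ^ a * n) n"
    using not_dvd_imp_multiplicity_0 by (metis less_numeral_extra(3))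
  moreover have "real (multiplicity 5 ((5 ^ a * n) choose n)) = real (digit_sum5 m) / 4"
    using four by linarith
  ultimately show ?thesis
    using fib by (simp add: m_def)
qed

end
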